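(* If $G$ is a Hamiltonian graph on $5$ or more vertices, then $G^3$ is $5$-ordered Hamiltonian.
   Context: All graphs are finite simple graphs. $d_G(v,w)$ denotes the distance in $G$ between vertices $v$ and $w$. For a positive integer $n$, the $n$-th power $G^n$ of a graph $G$ is the simple graph with the same vertex set as $G$ in which two distinct vertices $v,w$ are adjacent if and only if $d_G(v,w)\leq n$. A graph is Hamiltonian if it has a cycle through all its vertices. A graph $G$ is $k$-ordered Hamiltonian if for any sequence $v_1,v_2,\dots,v_k$ of $k$ distinct vertices of $G$ there is a Hamiltonian cycle in $G$ containing these vertices in the given order, i.e. traversing the cycle from $v_1$ in one of its two directions, one meets $v_1,v_2,\dots,v_k$ in this order before returning to $v_1$. *)

theory Defs
  imports "Graph_Theory.Graph_Theory" "HOL-Library.Sublist"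
begin

text \<open>
  A finite simple graph is a \<^locale>\<open>pair_graph\<close>: a finite, loop-free, symmetric digraph whose
  arcs are pairs, each edge being represented by its two orientations.
\<close>

text \<open>
  Unit arc weights turn the library's shortest-path cost into the number of edges; the
  value is \<open>\<infinity>\<close> if there is no walk.
\<close>

definition graph_dist :: "'a pair_pre_digraph \<Rightarrow> 'a \<Rightarrow> 'a \<Rightarrow> ereal" where
  "graph_dist G v w = wf_digraph.\<mu> (with_proj G) (\<lambda>_. 1) v w"

definition graph_power :: "'a pair_pre_digraph \<Rightarrow> nat \<Rightarrow> 'a pair_pre_digraph" where
  "graph_power G n =
     \<lparr> pverts = pverts G,
       parcs = {(v, w). v \<in> pverts G \<and> w \<in> pverts G \<and> v \<noteq> w \<and> graph_dist G v w \<le> ereal (real n)} \<rparr>"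

lemma pair_graph_graph_power:
  assumes "pair_graph G"
  shows "pair_graph (graph_power G n)"
proof -
  interpret G: pair_graph G by (fact assms)
  have rev: "G.awalk_cost (\<lambda>_. 1) p = real (length p)" for p :: "('a \<times> 'a) list"
    by (induct p) (auto simp: G.awalk_cost_def)
  have sym: "graph_dist G w v \<le> graph_dist G v w" for v w
    unfolding graph_dist_def G.\<mu>_def
  proof (rule INF_mono)
    fix p assume "p \<in> {p. G.awalk v p w}"
    then have p: "G.awalk v p w" by simp
    have "\<exists>q. G.awalk w q v \<and> length q = length p"
      using p
    proof (induct p arbitrary: v)
      case Nil
      then show ?case by (auto simp: G.awalk_Nil_iff)
    next
      case (Cons e p)
      then obtain q where q: "G.awalk w q (snd e)" "length q = length p"
        by (auto simp: G.awalk_Cons_iff)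
      have e: "e \<in> parcs G" "fst e = v" using Cons.prems by (auto simp: G.awalk_Cons_iff)
      have "(snd e, v) \<in> parcs G"
        using e G.pair_sym_arcs by (cases e) (auto simp: symmetric_def dest: symD)
      then have "G.awalk (snd e) [(snd e, v)] v"
        by (auto simp: G.awalk_Cons_iff G.awalk_Nil_iff dest: G.in_arcsD1 G.in_arcsD2)
      with q show ?case
        by (intro exI[of _ "q @ [(snd e, v)]"]) (auto intro: G.awalk_appendI)
    qed
    then show "\<exists>q\<in>{p. G.awalk w p v}. ereal (G.awalk_cost (\<lambda>_. 1) q) \<le> ereal (G.awalk_cost (\<lambda>_. 1) p)"
      by (auto simp: rev)
  qed
  show ?thesis
  proof unfold_locales
    show "finite (parcs (graph_power G n))"
      by (rule finite_subset[of _ "pverts G \<times> pverts G"]) (auto simp: graph_power_def)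
    show "symmetric (with_proj (graph_power G n))"
      unfolding symmetric_def
      by (auto simp: graph_power_def intro!: symI intro: order_trans[OF sym])
  qed (auto simp: graph_power_def)
qed

text \<open>
  The library's \<^const>\<open>pre_digraph.cycle\<close> is a list of consecutive arcs and thus has a starting
  vertex and a direction. It also admits \<open>a, b, a\<close>, which is not a cycle of an undirected
  graph, hence the bound on the length. The start vertices \<open>map fst p\<close> list each
  vertex of the cycle once.
\<close>

definition hamiltonian_cycle :: "'a pair_pre_digraph \<Rightarrow> ('a \<times> 'a) awalk \<Rightarrow> bool" where
  "hamiltonian_cycle G p \<longleftrightarrow>
     pre_digraph.cycle (with_proj G) p \<and> 3 \<le> length p \<and> set (map fst p) = pverts G"

definition hamiltonian :: "'a pair_pre_digraph \<Rightarrow> bool" where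
  "hamiltonian G \<longleftrightarrow> (\<exists>p. hamiltonian_cycle G p)"

text \<open>
  Here \<open>cs\<close> is the cyclic sequence of vertices of a cycle: in one of the two directions, the
  traversal starting (and, implicitly, ending) at the first of the given vertices meets the
  others in order.
\<close>

fun visits_in_order :: "'a list \<Rightarrow> 'a list \<Rightarrow> bool" where
  "visits_in_order cs [] \<longleftrightarrow> True"
| "visits_in_order cs (v # vs) \<longleftrightarrow>
     (\<exists>ds \<in> {cs, rev cs}. \<exists>i ws. rotate i ds = v # ws \<and> subseq vs ws)"

definition ordered_hamiltonian :: "nat \<Rightarrow> 'a pair_pre_digraph \<Rightarrow> bool" where
  "ordered_hamiltonian k G \<longleftrightarrow>
     (\<forall>vs. length vs = k \<and> distinct vs \<and> set vs \<subseteq> pverts G \<longrightarrow>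
        (\<exists>p. hamiltonian_cycle G p \<and> visits_in_order (map fst p) vs))"

end

(*
  Number the vertices of the Hamiltonian cycle cyclically; positions at distance at most 3 are
  adjacent in the cube. Up to rotation and reversal, the five vertices are prescribed in one
  of four orders relative to the cycle. The monotone order is the cycle itself. One or two
  swaps of disjoint pairs of neighbours are realised by replacing the stretch from p to q by
  a Hamiltonian path of it that meets q before p and whose ends lie close to p and q. The
  pentagram order is realised by going around the cycle twice.
*)

theory Submission
  imports Defs
begin

lemma subseq_rev:
  "subseq xs ys \<Longrightarrow> subseq (rev xs) (rev ys)"
  by (induction rule: list_emb.induct) (auto intro: list_emb_append_mono subseq_rev_drop_many)

section \<open>Lists of positions with steps of length at most three\<close>

definition near :: "nat \<Rightarrow> nat \<Rightarrow> bool" where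
  "near i j \<longleftrightarrow> i \<noteq> j \<and> i \<le> j + 3 \<and> j \<le> i + 3"

lemma near_sym: "near i j \<Longrightarrow> near j i"
  by (auto simp: near_def)

text \<open>The slack \<open>d\<close> is measured from the first position \<open>a\<close>, but
  \<open>e\<close> from the excluded bound \<open>b\<close>; thus \<open>e = 1\<close> means that
  the path ends exactly at \<open>b - 1\<close>.\<close>

definition interval_path :: "nat \<Rightarrow> nat \<Rightarrow> nat \<Rightarrow> nat \<Rightarrow> nat list \<Rightarrow> bool" where
  "interval_path d e a b xs \<longleftrightarrow>
     distinct xs \<and> set xs = {a..<b} \<and> successively near xs \<and> xs \<noteq> [] \<and>
     hd xs \<le> a + d \<and> b \<le> last xs + e"

lemma successively_near_upt: "successively near [a..<b]"
  by (induction b) (auto simp: successively_append_iff near_def)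

lemma interval_path_upt: "a < b \<Longrightarrow> interval_path 0 1 a b [a..<b]"
  by (auto simp: interval_path_def successively_near_upt)

text \<open>The step from \<open>last xs\<close> to \<open>hd ys\<close> has length at most
  \<open>e + d'\<close>, since both are measured from the common bound \<open>b\<close>.\<close>

lemma interval_path_append:
  assumes xs: "interval_path d e a b xs" and ys: "interval_path d' e' b c ys" and "e + d' \<le> 3"
  shows "interval_path d e' a c (xs @ ys)"
proof -
  have "xs \<noteq> []" "ys \<noteq> []" using xs ys by (auto simp: interval_path_def)
  then have "last xs \<in> set xs" "hd ys \<in> set ys" "hd xs \<in> set xs" "last ys \<in> set ys" by auto
  then have *: "a \<le> last xs" "last xs < b" "b \<le> hd ys" "hd ys < c"
    using xs ys by (auto simp: interval_path_def)
  have "near (last xs) (hd ys)"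
    using * assms by (auto simp: interval_path_def near_def)
  moreover have "{a..<b} \<union> {b..<c} = {a..<c}" using * by auto
  ultimately show ?thesis
    using xs ys by (auto simp: interval_path_def successively_append_iff)
qed

text \<open>A nonempty increasing piece starts without slack and ends at \<open>c - 1\<close>, which
  is better than any \<open>e \<ge> 1\<close>; for \<open>b = c\<close> nothing is appended.\<close>

lemma interval_path_append_upt:
  assumes "interval_path d e a b xs" "1 \<le> e" "e \<le> 3" "b \<le> c"
  shows "interval_path d e a c (xs @ [b..<c])"
proof (cases "b = c")
  case False
  then have "interval_path d 1 a c (xs @ [b..<c])"
    using assms by (intro interval_path_append[OF assms(1) interval_path_upt]) auto
  then show ?thesis using assms by (auto simp: interval_path_def)
qed (use assms in simp)

section \<open>Paths through an interval that meet its last position before its first\<close>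

definition stride3 :: "nat \<Rightarrow> nat \<Rightarrow> nat list" where
  "stride3 r k = map (\<lambda>i. r + 3 * i) [0..<k]"

lemma stride3_0 [simp]: "stride3 r 0 = []"
  by (simp add: stride3_def)

lemma set_stride3: "set (stride3 r k) = {r + 3 * i | i. i < k}"
  by (auto simp: stride3_def)

lemma distinct_stride3 [simp]: "distinct (stride3 r k)"
  by (auto simp: stride3_def distinct_map inj_on_def)

lemma length_stride3 [simp]: "length (stride3 r k) = k"
  by (simp add: stride3_def)

lemma stride3_eq_Nil_iff [simp]: "stride3 r k = [] \<longleftrightarrow> k = 0"
  by (simp add: stride3_def)

lemma hd_stride3 [simp]: "k > 0 \<Longrightarrow> hd (stride3 r k) = r"
  by (simp add: stride3_def hd_map)

lemma last_stride3 [simp]: "k > 0 \<Longrightarrow> last (stride3 r k) = r + 3 * (k - 1)"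
  by (simp add: stride3_def last_map)

lemma successively_stride3: "successively near (stride3 r k)"
  by (auto simp: stride3_def successively_map successively_conv_nth near_def)

lemma successively_rev_stride3: "successively near (rev (stride3 r k))"
  unfolding successively_rev
  by (rule successively_mono[OF successively_stride3]) (auto intro: near_sym)

text \<open>Only the junctions have to be checked. An empty strand drops its junctions; if the
  middle one is empty, \<open>q\<close> and \<open>p\<close> become neighbours.\<close>

lemma successively_near_strands:
  assumes "k = 0 \<or> near (a + 3 * (k - 1)) q"
    and "if l = 0 then near q p else near q (b + 3 * (l - 1)) \<and> near b p"
    and "m = 0 \<or> near p c"
  shows "successively near (stride3 a k @ q # rev (stride3 b l) @ p # stride3 c m)"
proof -
  have C: "successively near (p # stride3 c m)"
    using assms(3) by (cases "m = 0") (auto simp: successively_Cons successively_stride3)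
  have "successively near (q # rev (stride3 b l) @ p # stride3 c m)"
  proof (cases "l = 0")
    case True
    then show ?thesis using C assms(2) by (simp add: successively_Cons)
  next
    case False
    then show ?thesis using C assms(2)
      by (simp add: successively_Cons successively_append_iff successively_rev_stride3
          hd_rev last_rev del: successively_rev)
  qed
  then show ?thesis
    using assms(1) by (cases "k = 0") (auto simp: successively_append_iff successively_stride3)
qed

lemma stride3_disjoint: "a mod 3 \<noteq> b mod 3 \<Longrightarrow> set (stride3 a k) \<inter> set (stride3 b l) = {}"
  by (auto simp: set_stride3) (metis mod_mult_self2)

lemma notin_stride3_below: "p < a \<Longrightarrow> p \<notin> set (stride3 a k)"
  by (auto simp: set_stride3)

lemma notin_stride3_above: "a + 3 * k < q + 3 \<Longrightarrow> q \<notin> set (stride3 a k)"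
  by (auto simp: set_stride3)

text \<open>The strands lie in different residue classes modulo \<open>3\<close>, and the last three
  bounds put the top of each nonempty strand below \<open>q\<close>.\<close>

lemma distinct_strands:
  assumes "a mod 3 \<noteq> b mod 3" "a mod 3 \<noteq> c mod 3" "b mod 3 \<noteq> c mod 3"
    and "p < a" "p < b" "p < c" "p < q"
    and "a + 3 * k < q + 3" "b + 3 * l < q + 3" "c + 3 * m < q + 3"
  shows "distinct (stride3 a k @ q # rev (stride3 b l) @ p # stride3 c m)"
  using stride3_disjoint[OF assms(1), of k l] stride3_disjoint[OF assms(2), of k m]
    stride3_disjoint[OF assms(3), of l m] notin_stride3_below notin_stride3_above assms(4-)
  by (auto 4 2)

text \<open>
  Walk up one residue class modulo \<open>3\<close> to \<open>q\<close>, down a second one to \<open>p\<close>, and up the third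
  one. Which class contains \<open>q\<close> depends on \<open>q - p\<close> modulo \<open>3\<close>.
\<close>

lemma ex_interval_path_swap:
  assumes "p < q"
  shows "\<exists>xs. interval_path 2 2 p (Suc q) xs \<and> subseq [q, p] xs"
proof -
  have main: ?thesis
    if dist: "distinct (A @ q # rev B @ p # C)"
      and sub: "set A \<union> set B \<union> set C \<subseteq> {p..q}"
      and len: "length A + length B + length C + 2 = q + 1 - p"
      and succ: "successively near (A @ q # rev B @ p # C)"
      and ends: "hd (A @ [q]) \<le> p + 2" "q \<le> last (p # C) + 1" for A B C
  proof -
    let ?xs = "A @ q # rev B @ p # C"
    \<comment> \<open>A list inside \<open>{p..q}\<close> without repetitions and of the right
      length exhausts the interval.\<close>
    have "length ?xs = card {p..q}" using len by simp
    then have "card (set ?xs) = card {p..q}"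
      by (simp only: distinct_card[OF dist])
    moreover have "set ?xs \<subseteq> {p..q}"
      using sub assms by simp
    ultimately have "set ?xs = {p..q}"
      by (metis card_subset_eq finite_atLeastAtMost)
    then have "set ?xs = {p..<Suc q}"
      by (simp only: atLeastLessThanSuc_atLeastAtMost)
    moreover have "hd ?xs = hd (A @ [q])" by (cases A) auto
    moreover have "last ?xs = last (p # C)" by auto
    ultimately have "interval_path 2 2 p (Suc q) ?xs"
      using dist succ ends unfolding interval_path_def by (simp del: set_append)
    moreover have "subseq ([] @ [q] @ [] @ [p] @ []) (A @ [q] @ rev B @ [p] @ C)"
      by (intro list_emb_append_mono) auto
    ultimately show ?thesis by auto
  qed
  \<comment> \<open>\<open>k\<close> counts the complete triples among the \<open>q - p - 1\<close>
    positions strictly between \<open>p\<close> and \<open>q\<close>. In all three cases the path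
    starts at \<open>p + 1\<close> or \<open>p + 2\<close> and ends at \<open>q - 1\<close>.\<close>
  define k where "k = (q - p - 1) div 3"
  consider "q = p + 3 * k + 1" | "q = p + 3 * k + 2" | "q = p + 3 * k + 3"
    using assms unfolding k_def by linarith
  then show ?thesis
  proof cases
    case 1
    show ?thesis
    proof (rule main[of "stride3 (p + 2) k" "stride3 (p + 1) k" "stride3 (p + 3) k"])
      show "successively near (stride3 (p + 2) k @ q # rev (stride3 (p + 1) k) @ p # stride3 (p + 3) k)"
        using 1 by (intro successively_near_strands) (auto simp: near_def)
      show "distinct (stride3 (p + 2) k @ q # rev (stride3 (p + 1) k) @ p # stride3 (p + 3) k)"
        using 1 by (intro distinct_strands; simp; presburger)
      show "hd (stride3 (p + 2) k @ [q]) \<le> p + 2" "q \<le> last (p # stride3 (p + 3) k) + 1"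
        using 1 by (cases "k = 0"; simp add: hd_append)+
    qed (use 1 in \<open>auto simp: set_stride3\<close>)
  next
    case 2
    show ?thesis
    proof (rule main[of "stride3 (p + 2) k" "stride3 (p + 3) k" "stride3 (p + 1) (k + 1)"])
      show "successively near
        (stride3 (p + 2) k @ q # rev (stride3 (p + 3) k) @ p # stride3 (p + 1) (k + 1))"
        using 2 by (intro successively_near_strands) (auto simp: near_def)
      show "distinct
        (stride3 (p + 2) k @ q # rev (stride3 (p + 3) k) @ p # stride3 (p + 1) (k + 1))"
        using 2 by (intro distinct_strands; simp; presburger)
      show "hd (stride3 (p + 2) k @ [q]) \<le> p + 2" "q \<le> last (p # stride3 (p + 1) (k + 1)) + 1"
        using 2 by (cases "k = 0"; simp add: hd_append)+
    qed (use 2 in \<open>auto simp: set_stride3\<close>)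
  next
    case 3
    show ?thesis
    proof (rule main[of "stride3 (p + 1) (k + 1)" "stride3 (p + 3) k" "stride3 (p + 2) (k + 1)"])
      show "successively near
        (stride3 (p + 1) (k + 1) @ q # rev (stride3 (p + 3) k) @ p # stride3 (p + 2) (k + 1))"
        using 3 by (intro successively_near_strands) (auto simp: near_def)
      show "distinct
        (stride3 (p + 1) (k + 1) @ q # rev (stride3 (p + 3) k) @ p # stride3 (p + 2) (k + 1))"
        using 3 by (intro distinct_strands; simp; presburger)
      show "hd (stride3 (p + 1) (k + 1) @ [q]) \<le> p + 2" "q \<le> last (p # stride3 (p + 2) (k + 1)) + 1"
        using 3 by (cases "k = 0"; simp add: hd_append)+
    qed (use 3 in \<open>auto simp: set_stride3\<close>)
  qed
qed

text \<open>Reversing the list and reflecting positions by \<open>i \<mapsto> p + q - i\<close>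
  together keep \<open>q\<close> before \<open>p\<close> but exchange the two ends. The end at
  \<open>q - 1\<close> or later becomes a start at \<open>p + 1\<close> or earlier, which can follow
  a path with end slack \<open>2\<close>.\<close>

lemma ex_interval_path_swap_mirror:
  assumes "p < q"
  shows "\<exists>xs. interval_path 1 3 p (Suc q) xs \<and> subseq [q, p] xs"
proof -
  obtain xs where xs: "interval_path 2 2 p (Suc q) xs" "subseq [q, p] xs"
    using ex_interval_path_swap[OF assms] by blast
  let ?g = "\<lambda>i. p + q - i"
  let ?ys = "map ?g (rev xs)"
  have set_xs: "set xs = {p..<Suc q}" and ne: "xs \<noteq> []"
    using xs by (auto simp: interval_path_def)
  have "last xs \<in> set xs" "hd xs \<in> set xs" using ne by auto
  then have bounds: "p \<le> last xs" "last xs \<le> q" "p \<le> hd xs" "hd xs \<le> q"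
    using set_xs by auto
  have "set ?ys = {p..<Suc q}"
  proof
    show "{p..<Suc q} \<subseteq> set ?ys"
    proof
      fix i assume "i \<in> {p..<Suc q}"
      then have "i = ?g (?g i)" "?g i \<in> set xs" by (auto simp: set_xs)
      then show "i \<in> set ?ys" by (metis image_eqI set_map set_rev)
    qed
  qed (auto simp: set_xs)
  moreover have "distinct ?ys"
    using xs by (auto simp: distinct_map interval_path_def inj_on_def)
  moreover have "near (?g j) (?g i)" if "i \<in> set xs" "j \<in> set xs" "near i j" for i j
  proof -
    have "i \<le> q" "j \<le> q" using that set_xs by auto
    with \<open>near i j\<close> show ?thesis unfolding near_def by linarith
  qed
  then have "successively near ?ys"
    unfolding successively_map successively_rev
    using xs(1) unfolding interval_path_def
    by (elim conjE) (rule successively_mono)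
  moreover have "hd ?ys = ?g (last xs)" "last ?ys = ?g (hd xs)"
    using ne by (auto simp: hd_map last_map hd_rev last_rev)
  moreover have "hd xs \<le> p + 2" "q \<le> last xs + 1"
    using xs(1) by (auto simp: interval_path_def)
  ultimately have "interval_path 1 3 p (Suc q) ?ys"
    using ne bounds unfolding interval_path_def by auto
  moreover have "subseq (map ?g (rev [q, p])) ?ys"
    using xs(2) by (intro subseq_map subseq_rev)
  ultimately show ?thesis by auto
qed

section \<open>Selections that never skip three consecutive positions\<close>

lemma le_last_filter_upt:
  assumes "i < n" "P i"
  shows "i \<le> last (filter P [0..<n])"
  using assms by (induction n) (auto simp: less_Suc_eq)

lemma le_last_filter_upt_3:
  assumes "\<And>i. i + 2 < n \<Longrightarrow> P i \<or> P (i + 1) \<or> P (i + 2)"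
  shows "n \<le> last (filter P [0..<n]) + 3"
\<comment> \<open>For \<open>n < 3\<close> the filtered list may be empty; the bound then holds
  whatever \<open>last []\<close> is.\<close>
proof (cases "n < 3")
  case False
  then obtain i where "n = i + 3" using le_Suc_ex[of 3 n] by (metis add.commute not_less)
  then have "\<exists>j\<in>{i..<n}. P j"
    using assms[of i] by force
  then obtain j where "i \<le> j" "j < n" "P j"
    by auto
  then show ?thesis using le_last_filter_upt[of j n P] \<open>n = i + 3\<close> by simp
qed simp

lemma successively_near_filter_upt:
  assumes "\<And>i. i + 2 < n \<Longrightarrow> P i \<or> P (i + 1) \<or> P (i + 2)"
  shows "successively near (filter P [0..<n])"
  using assms
proof (induction n)
  case (Suc n)
  have "last (filter P [0..<n]) < n" if "filter P [0..<n] \<noteq> []"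
    using last_in_set[OF that] by auto
  then show ?case
    using Suc le_last_filter_upt_3[of n P]
    by (auto simp: successively_append_iff near_def)
qed auto

section \<open>Closed lists through given vertices\<close>

definition ham_list :: "('a \<Rightarrow> 'a \<Rightarrow> bool) \<Rightarrow> 'a set \<Rightarrow> 'a list \<Rightarrow> bool" where
  "ham_list E V ws \<longleftrightarrow>
     ws \<noteq> [] \<and> distinct ws \<and> set ws = V \<and> successively E ws \<and> E (last ws) (hd ws)"

lemma ham_list_append_commute: "ham_list E V (xs @ ys) \<Longrightarrow> ham_list E V (ys @ xs)"
  by (cases "xs = []"; cases "ys = []")
    (auto simp: ham_list_def successively_append_iff)

lemma ham_list_rev: "symp E \<Longrightarrow> ham_list E V xs \<Longrightarrow> ham_list E V (rev xs)"
  by (auto simp: ham_list_def hd_rev last_rev dest: sympD elim: successively_mono)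

text \<open>The closed list is rotated so that the first prescribed vertex is its head. Only
  nonempty \<open>vs\<close> are meant.\<close>

definition traverses :: "('a \<Rightarrow> 'a \<Rightarrow> bool) \<Rightarrow> 'a set \<Rightarrow> 'a list \<Rightarrow> bool" where
  "traverses E V vs \<longleftrightarrow> (\<exists>ws. ham_list E V (hd vs # ws) \<and> subseq (tl vs) ws)"

text \<open>Splitting the closed list as \<open>v # A @ u # B\<close> and rotating it to
  \<open>u # B @ v # A\<close> moves \<open>v\<close> behind everything found in
  \<open>B\<close>.\<close>

lemma traverses_rotate1:
  assumes "traverses E V (v # u # vs)"
  shows "traverses E V (u # vs @ [v])"
proof -
  obtain ws where ws: "ham_list E V (v # ws)" "subseq (u # vs) ws"
    using assms by (auto simp: traverses_def)
  then obtain A B where AB: "ws = A @ u # B" "subseq vs B"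
    by (auto dest: list_emb_ConsD)
  have "ham_list E V (u # B @ v # A)"
    using ham_list_append_commute[of E V "v # A" "u # B"] ws AB by simp
  moreover have "subseq (vs @ [v]) (B @ v # A)"
    using AB by (intro list_emb_append_mono) auto
  ultimately show ?thesis by (auto simp: traverses_def)
qed

lemma traverses_rev:
  assumes "symp E" "traverses E V (v # vs)"
  shows "traverses E V (v # rev vs)"
proof -
  obtain ws where ws: "ham_list E V (v # ws)" "subseq vs ws"
    using assms by (auto simp: traverses_def)
  have "ham_list E V (v # rev ws)"
    using ham_list_append_commute[of E V "rev ws" "[v]"] ham_list_rev[OF assms(1) ws(1)] by simp
  then show ?thesis
    using subseq_rev[OF ws(2)] by (auto simp: traverses_def)
qed

section \<open>Periodic enumerations of the vertices; the monotone and swapped orders\<close>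

text \<open>Positions are all natural numbers instead of residues modulo \<open>n\<close>, so that
  nearness across the end of a turn and walks of several turns need no modular arithmetic. Together,
  \<open>image_f\<close> and \<open>card_V\<close> make \<open>f\<close> injective on one
  period.\<close>

locale cyclic_sequence =
  fixes f :: "nat \<Rightarrow> 'a" and n :: nat and V :: "'a set" and E :: "'a \<Rightarrow> 'a \<Rightarrow> bool"
  assumes f_add_period: "f (i + n) = f i"
    and image_f: "f ` {..<n} = V"
    and card_V: "card V = n"
    and n_ge: "5 \<le> n"
    and E_near: "near i j \<Longrightarrow> E (f i) (f j)"
    and sym_E: "symp E"
begin

lemma f_add_multiple: "f (i + k * n) = f i"
  by (induction k) (use f_add_period[of "i + _ * n"] in \<open>auto simp: algebra_simps\<close>)

lemma shift: "cyclic_sequence (\<lambda>i. f (b + i)) n V E"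
proof
  show "(\<lambda>i. f (b + i)) ` {..<n} = V"
  proof (induction b)
    case (Suc b)
    have "(\<lambda>i. f (Suc b + i)) ` {..<n} = (\<lambda>i. f (b + i)) ` Suc ` {..<n}"
      by (auto simp: image_iff)
    also have "\<dots> = (\<lambda>i. f (b + i)) ` {..<n}"
    proof -
      \<comment> \<open>A shift by one trades position \<open>0\<close> for position
        \<open>n\<close>, which carries the same vertex.\<close>
      have eq: "insert 0 (Suc ` {..<n}) = insert n {..<n}"
        by (metis lessThan_Suc lessThan_Suc_eq_insert_0)
      have "f (b + 0) = f (b + n)" by (simp add: f_add_period)
      moreover have "0 \<in> {..<n}" "n \<in> Suc ` {..<n}" using n_ge
        by (auto simp: image_iff intro: bexI[of _ "n - 1"])
      ultimately show ?thesis
        using arg_cong[OF eq, of "image (\<lambda>i. f (b + i))"]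
        by (metis (no_types, lifting) image_insert imageI insert_absorb)
    qed
    finally show ?case using Suc by simp
  qed (simp add: image_f)
  show "f (b + (i + n)) = f (b + i)" for i
    using f_add_period[of "b + i"] by (simp add: add.assoc)
  show "E (f (b + i)) (f (b + j))" if "near i j" for i j
    using that by (intro E_near) (auto simp: near_def)
qed (use card_V n_ge sym_E in auto)

text \<open>The walk may wind around the cycle \<open>k\<close> times: it closes up at
  \<open>i + k * n\<close>, another copy of its start. No vertex repeats, because \<open>n\<close>
  entries cover all \<open>n\<close> vertices.\<close>

lemma traverses_closed_walk:
  assumes succ: "successively near (i # is)"
    and closed: "near (last (i # is)) (i + k * n)"
    and image: "f ` set (i # is) = V"
    and len: "length (i # is) = n"
    and sub: "subseq js is"
  shows "traverses E V (map f (i # js))"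
proof -
  have "distinct (map f (i # is))"
    using image len card_V by (intro card_distinct) simp
  moreover have "successively E (map f (i # is))"
    unfolding successively_map using succ E_near by (rule successively_mono) auto
  moreover have "E (last (map f (i # is))) (f i)"
    using E_near[OF closed] unfolding f_add_multiple by (subst last_map) simp_all
  ultimately have "ham_list E V (f i # map f is)"
    using image by (auto simp: ham_list_def)
  then show ?thesis
    using subseq_map[OF sub] by (auto simp: traverses_def)
qed

text \<open>Start slack \<open>0\<close> forces the path to begin at \<open>0\<close>, and
  \<open>e \<le> 3\<close> brings its end near \<open>n\<close>, the copy of \<open>0\<close> one
  turn later.\<close>

lemma traverses_interval_path:
  assumes xs: "interval_path 0 e 0 n xs" "e \<le> 3" and sub: "subseq (0 # js) xs"
  shows "traverses E V (map f (0 # js))"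
proof -
  obtain ys where ys: "xs = 0 # ys"
    using xs(1) by (cases xs) (auto simp: interval_path_def)
  have "last xs \<in> set xs" using ys by simp
  then have "last xs < n" using xs by (auto simp: interval_path_def)
  then have "near (last (0 # ys)) (0 + 1 * n)"
    using xs ys by (auto simp: interval_path_def near_def)
  moreover have set: "set (0 # ys) = {..<n}" and "distinct (0 # ys)"
    and "successively near (0 # ys)"
    using xs(1) unfolding interval_path_def ys by (simp_all only: lessThan_atLeast0)
  moreover from this have "length (0 # ys) = n"
    using distinct_card[of "0 # ys"] by (simp only: card_lessThan)
  moreover have "f ` set (0 # ys) = V" by (simp only: set image_f)
  moreover have "subseq js ys" using sub ys by simp
  ultimately show ?thesis by (intro traverses_closed_walk)
qed

lemma subseq_upt: "sorted_wrt (<) is \<Longrightarrow> set is \<subseteq> {a..<b} \<Longrightarrow> subseq is [a..<b]"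
  by (intro sorted_subset_imp_subseq) auto

lemma traverses_monotone:
  assumes "0 < a" "a < b" "b < c" "c < d" "d < n"
  shows "traverses E V (map f [0, a, b, c, d])"
proof (rule traverses_interval_path[OF interval_path_upt])
  show "subseq [0, a, b, c, d] [0..<n]"
    using assms by (intro subseq_upt) auto
qed (use assms in auto)

lemma traverses_one_swap:
  assumes "0 < a" "a < b" "b < c" "c < d" "d < n"
  shows "traverses E V (map f [0, a, b, d, c])"
proof -
  obtain X where X: "interval_path 2 2 c (Suc d) X" "subseq [d, c] X"
    using ex_interval_path_swap assms by blast
  \<comment> \<open>The junction before \<open>X\<close> uses the full allowance
    \<open>1 + 2\<close>.\<close>
  have "interval_path 0 2 0 n (([0..<c] @ X) @ [Suc d..<n])"
    using assms X
    by (intro interval_path_append_upt interval_path_append[OF interval_path_upt]) auto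
  moreover have "subseq (([0, a, b] @ [d, c]) @ []) (([0..<c] @ X) @ [Suc d..<n])"
    using assms X by (intro list_emb_append_mono subseq_upt) auto
  ultimately show ?thesis
    using traverses_interval_path[of 2] by fastforce
qed

lemma traverses_two_swaps:
  assumes "0 < a" "a < b" "b < c" "c < d" "d < n"
  shows "traverses E V (map f [0, b, a, d, c])"
proof -
  obtain X where X: "interval_path 2 2 a (Suc b) X" "subseq [b, a] X"
    using ex_interval_path_swap assms by blast
  \<comment> \<open>If \<open>c = Suc b\<close>, the two swapped stretches meet directly. The first
    has end slack \<open>2\<close>, so the second may only have start slack \<open>1\<close>. Its
    end slack \<open>3\<close> is affordable, as whatever follows has start slack
    \<open>0\<close>.\<close>
  obtain Y where Y: "interval_path 1 3 c (Suc d) Y" "subseq [d, c] Y"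
    using ex_interval_path_swap_mirror assms by blast
  let ?xs = "((([0..<a] @ X) @ [Suc b..<c]) @ Y) @ [Suc d..<n]"
  have "interval_path 0 2 0 c (([0..<a] @ X) @ [Suc b..<c])"
    using assms X
    by (intro interval_path_append_upt interval_path_append[OF interval_path_upt]) auto
  from interval_path_append[OF this Y(1)] have "interval_path 0 3 0 n ?xs"
    using assms by (intro interval_path_append_upt) auto
  moreover have "subseq (((([0] @ [b, a]) @ []) @ [d, c]) @ []) ?xs"
    using assms X Y by (intro list_emb_append_mono subseq_upt) auto
  ultimately show ?thesis
    using traverses_interval_path[of 3] by fastforce
qed

end

section \<open>The pentagram order\<close>

text \<open>Truth stands for the first lap. Outside \<open>A\<close> and \<open>B\<close> every
  positive position takes the other lap than its predecessor, so neighbours can share a lap only at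
  a forced position.\<close>

primrec lap :: "nat set \<Rightarrow> nat set \<Rightarrow> nat \<Rightarrow> bool" where
  "lap A B 0 = True"
| "lap A B (Suc j) = (if Suc j \<in> A then True else if Suc j \<in> B then False else \<not> lap A B j)"

lemma lap_in [simp]: "j \<in> A \<Longrightarrow> lap A B j"
  by (cases j) auto

lemma not_lap_in [simp]: "j \<in> B \<Longrightarrow> 0 < j \<Longrightarrow> j \<notin> A \<Longrightarrow> \<not> lap A B j"
  by (cases j) auto

context cyclic_sequence
begin

text \<open>
  The cycle is run through twice. The first lap visits \<open>0\<close>, \<open>b\<close>, \<open>d\<close>, the second one \<open>a\<close>, \<open>c\<close>,
  and the other positions alternate between the laps. Since \<open>a\<close>, \<open>b\<close>, \<open>c\<close>, \<open>d\<close> belong to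
  the two laps in turn, neither lap misses three consecutive positions.
\<close>

lemma traverses_two_laps:
  assumes "0 < a" "a < b" "b < c" "c < d" "d < n"
  shows "traverses E V (map f [0, b, d, a, c])"
proof -
  define P where "P = lap {b, d} {a, c}"
  have P: "P 0" "P b" "P d" "\<not> P a" "\<not> P c" "\<not> P 1"
    using assms by (auto simp: P_def)
  have P_Suc: "P (Suc j) \<longleftrightarrow> \<not> P j" if "Suc j \<notin> {a, b, c, d}" for j
    using that by (auto simp: P_def)
  \<comment> \<open>If \<open>j + 1\<close> and \<open>j + 2\<close> are both prescribed, they are
    neighbours in the chain \<open>a\<close>, \<open>b\<close>, \<open>c\<close>, \<open>d\<close>
    and lie in different laps; otherwise one of them is unforced and differs from its
    predecessor.\<close>
  have change: "P j \<noteq> P (j + 1) \<or> P (j + 1) \<noteq> P (j + 2)" for j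
  proof (cases "Suc j \<in> {a, b, c, d} \<and> Suc (Suc j) \<in> {a, b, c, d}")
    case True
    then show ?thesis using P assms by auto
  next
    case False
    then show ?thesis using P_Suc[of j] P_Suc[of "Suc j"] by auto
  qed
  let ?L = "filter P [0..<n]"
  let ?M = "filter (\<lambda>j. \<not> P j) [0..<n]"
  have hd_L: "[0..<n] = 0 # 1 # [2..<n]"
    using n_ge by (simp add: upt_conv_Cons numeral_2_eq_2)
  obtain L' where L: "?L = 0 # L'" using P hd_L by simp
  obtain M' where M: "?M = 1 # M'" using P hd_L by simp
  have last_L: "last ?L < n" "last ?M < n"
  proof -
    have "?L \<noteq> []" "?M \<noteq> []" by (simp add: L, simp add: M)
    from this[THEN last_in_set] show "last ?L < n" "last ?M < n" by auto
  qed
  \<comment> \<open>The second lap starts at \<open>n + 1\<close>, so the first one must reach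
    \<open>n - 2\<close>, one more than the general bound gives. It does: \<open>n - 1\<close> is
    either \<open>d\<close>, which belongs to the first lap, or unforced, and then
    \<open>n - 2\<close> and \<open>n - 1\<close> lie in different laps.\<close>
  define m where "m = n - 2"
  then have m: "n = Suc (Suc m)"
    using n_ge by simp
  have "P (Suc m) \<or> P m"
  proof (cases "Suc m = d")
    case False
    then have "Suc m \<notin> {a, b, c, d}" using assms m by simp
    then show ?thesis by (simp add: P_Suc)
  qed (simp add: P)
  then obtain j where "m \<le> j" "j < n" "P j"
    using m that[of m] that[of "Suc m"] by auto
  then have "m \<le> last ?L"
    using le_last_filter_upt[of j n P] by linarith
  then have near1: "near (last ?L) (n + 1)"
    using last_L(1) m unfolding near_def by linarith
  have "n \<le> last ?M + 3"
    using change by (intro le_last_filter_upt_3) blast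
  then have near2: "near (n + last ?M) (2 * n)"
    using last_L(2) unfolding near_def by linarith
  have "successively near ?L" "successively near ?M"
    using change by (intro successively_near_filter_upt; blast)+
  moreover from this have "successively near (map ((+) n) ?M)"
    unfolding successively_map by (elim successively_mono) (auto simp: near_def)
  moreover have "hd (map ((+) n) ?M) = n + 1" by (simp add: M)
  then have "near (last ?L) (hd (map ((+) n) ?M))" by (simp only: near1)
  ultimately have succ: "successively near (?L @ map ((+) n) ?M)"
    by (intro successively_append_iff[THEN iffD2] conjI disjI2)
  have period: "f (n + i) = f i" for i
    using f_add_period[of i] by (simp only: add.commute)
  have "f ` set (?L @ map ((+) n) ?M) = f ` (set ?L \<union> set ?M)"
    by (simp only: set_append set_map image_Un image_image period)
  also have "set ?L \<union> set ?M = {..<n}" by auto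
  finally have "f ` set (?L @ map ((+) n) ?M) = V" by (simp only: image_f)
  moreover have "length (?L @ map ((+) n) ?M) = n"
    using sum_length_filter_compl[of P "[0..<n]"] by simp
  moreover have "subseq ([b, d] @ [n + a, n + c]) (L' @ map ((+) n) ?M)"
  proof (intro list_emb_append_mono)
    have "subseq [0, b, d] ?L"
      using assms P by (intro sorted_subset_imp_subseq) (auto intro: sorted_wrt_filter)
    then show "subseq [b, d] L'" using L by simp
    have "subseq [a, c] ?M"
      using assms P by (intro sorted_subset_imp_subseq) (auto intro: sorted_wrt_filter)
    from subseq_map[OF this, of "(+) n"]
    show "subseq [n + a, n + c] (map ((+) n) ?M)" by simp
  qed
  moreover have "last (?L @ map ((+) n) ?M) = n + last ?M"
    by (simp add: M last_map)
  then have "near (last (?L @ map ((+) n) ?M)) (0 + 2 * n)"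
    using near2 by (simp only: add_0)
  ultimately have "traverses E V (map f (0 # [b, d] @ [n + a, n + c]))"
    using succ unfolding L append_Cons by (intro traverses_closed_walk)
  then show ?thesis by (simp add: period)
qed

section \<open>All orders of five positions\<close>

lemma traverses_patterns:
  assumes "i0 < i1" "i1 < i2" "i2 < i3" "i3 < i4" "i4 < i0 + n"
  shows "traverses E V (map f [i0, i1, i2, i3, i4])"
    and "traverses E V (map f [i0, i1, i2, i4, i3])"
    and "traverses E V (map f [i0, i2, i1, i4, i3])"
    and "traverses E V (map f [i0, i2, i4, i1, i3])"
proof -
  interpret shifted: cyclic_sequence "\<lambda>i. f (i0 + i)" n V E
    by (rule shift)
  let ?d = "\<lambda>i. i - i0"
  have *: "0 < ?d i1" "?d i1 < ?d i2" "?d i2 < ?d i3" "?d i3 < ?d i4" "?d i4 < n"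
    using assms by auto
  show "traverses E V (map f [i0, i1, i2, i3, i4])"
    using shifted.traverses_monotone[OF *] assms by simp
  show "traverses E V (map f [i0, i1, i2, i4, i3])"
    using shifted.traverses_one_swap[OF *] assms by simp
  show "traverses E V (map f [i0, i2, i1, i4, i3])"
    using shifted.traverses_two_swaps[OF *] assms by simp
  show "traverses E V (map f [i0, i2, i4, i1, i3])"
    using shifted.traverses_two_laps[OF *] assms by simp
qed

text \<open>Five positions have twelve cyclic orders up to reversal. Under rotation of the positions
  these fall into classes of sizes 1, 5, 5 and 1: monotone, one swap, two swaps, pentagram. The
  members of a class come from applying its pattern to the windows that start at \<open>0\<close>,
  \<open>i\<close>, \<open>j\<close>, \<open>k\<close>, \<open>l\<close>.\<close>

lemma traverses_sorted:
  assumes "0 < i" "i < j" "j < k" "k < l" "l < n"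
  shows "traverses E V (map f [0, i, j, k, l])" "traverses E V (map f [0, i, j, l, k])"
    "traverses E V (map f [0, l, i, j, k])" "traverses E V (map f [0, j, k, l, i])"
    "traverses E V (map f [0, j, i, k, l])" "traverses E V (map f [0, i, k, j, l])"
    "traverses E V (map f [0, j, i, l, k])" "traverses E V (map f [0, l, i, k, j])"
    "traverses E V (map f [0, j, l, k, i])" "traverses E V (map f [0, l, j, i, k])"
    "traverses E V (map f [0, k, j, l, i])" "traverses E V (map f [0, j, l, i, k])"
proof -
  have rot: "traverses E V [y, z, u, v, x]" if "traverses E V [x, y, z, u, v]" for x y z u v
    using traverses_rotate1[OF that] by simp
  have period: "f (m + n) = f m" "f n = f 0" for m
    using f_add_period[of 0] by (simp_all add: f_add_period)
  have 0: "0 < i" "i < j" "j < k" "k < l" "l < 0 + n"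
    and 1: "i < j" "j < k" "k < l" "l < n" "n < i + n"
    and 2: "j < k" "k < l" "l < n" "n < i + n" "i + n < j + n"
    and 3: "k < l" "l < n" "n < i + n" "i + n < j + n" "j + n < k + n"
    and 4: "l < n" "n < i + n" "i + n < j + n" "j + n < k + n" "k + n < l + n"
    using assms by simp_all
  note * = traverses_patterns[OF 0, simplified period list.map]
    and from_i = traverses_patterns[OF 1, simplified period list.map]
    and from_j = traverses_patterns[OF 2, simplified period list.map]
    and from_k = traverses_patterns[OF 3, simplified period list.map]
    and from_l = traverses_patterns[OF 4, simplified period list.map]
  \<comment> \<open>In each window the number of applications of \<open>rot\<close> is what brings
    \<open>0\<close>, possibly written as \<open>n\<close>, to the front.\<close>
  note ** = *(1,2) from_i(2)[THEN rot, THEN rot, THEN rot]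
    from_j(2)[THEN rot, THEN rot, THEN rot, THEN rot]
    from_k(2)[THEN rot, THEN rot] from_l(2)[THEN rot] *(3) from_i(3)[THEN rot, THEN rot, THEN rot]
    from_j(3)[THEN rot, THEN rot, THEN rot, THEN rot] from_k(3)[THEN rot]
    from_l(3)[THEN rot, THEN rot] *(4)
  show "traverses E V (map f [0, i, j, k, l])" "traverses E V (map f [0, i, j, l, k])"
    "traverses E V (map f [0, l, i, j, k])" "traverses E V (map f [0, j, k, l, i])"
    "traverses E V (map f [0, j, i, k, l])" "traverses E V (map f [0, i, k, j, l])"
    "traverses E V (map f [0, j, i, l, k])" "traverses E V (map f [0, l, i, k, j])"
    "traverses E V (map f [0, j, l, k, i])" "traverses E V (map f [0, l, j, i, k])"
    "traverses E V (map f [0, k, j, l, i])" "traverses E V (map f [0, j, l, i, k])"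
    unfolding list.map by (fact **)+
qed

lemma traverses_from_0:
  assumes "distinct [0, p, q, r, s]" "p < n" "q < n" "r < n" "s < n"
  shows "traverses E V (map f [0, p, q, r, s])"
proof -
  have reversed: "traverses E V (map f [0, s, r, q, p])"
    if "traverses E V (map f [0, p, q, r, s])" for p q r s
    using traverses_rev[OF sym_E, of V "f 0" "map f [p, q, r, s]"] that by simp
  have "0 < p" "0 < q" "0 < r" "0 < s" "p < q \<or> q < p" "p < r \<or> r < p" "p < s \<or> s < p"
    "q < r \<or> r < q" "q < s \<or> s < q" "r < s \<or> s < r"
    using assms by auto
  then show ?thesis
    using assms(2-)
    \<comment> \<open>Each choice of comparisons is a tournament on \<open>p\<close>,
      \<open>q\<close>, \<open>r\<close>, \<open>s\<close> and so contains a chain through all four,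
      even when the choice is contradictory. One of the twelve orders or its reversal then fits the
      goal.\<close>
    by - (elim disjE; (rule traverses_sorted traverses_sorted[THEN reversed]; assumption))
qed

end

section \<open>Hamiltonian cycles as lists of vertices\<close>

lemma (in pair_wf_digraph) awalk_zip:
  assumes "u \<in> pverts G" "successively (\<lambda>v w. (v, w) \<in> parcs G) (u # ws)"
  shows "awalk u (zip (u # ws) ws) (last (u # ws))"
  using assms
proof (induction ws arbitrary: u)
  case (Cons w ws)
  then show ?case
    by (auto simp: awalk_Cons_iff dest: in_arcsD2)
qed (simp add: awalk_Nil_iff)

lemma map_fst_zip_tl: "map fst (zip (u # ws @ [u]) (ws @ [u])) = u # ws"
  by (simp add: map_fst_zip_take)

lemma hamiltonian_cycle_if_ham_list:
  assumes "pair_graph G" "ham_list (\<lambda>v w. (v, w) \<in> parcs G) (pverts G) (u # ws)" "2 \<le> length ws"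
  obtains p where "hamiltonian_cycle G p" "map fst p = u # ws"
proof
  interpret pair_graph G by fact
  let ?p = "zip (u # ws @ [u]) (ws @ [u])"
  show fst: "map fst ?p = u # ws" by (rule map_fst_zip_tl)
  have u: "u \<in> pverts G" using assms by (auto simp: ham_list_def)
  have "successively (\<lambda>v w. (v, w) \<in> parcs G) ((u # ws) @ [u])"
    using assms(2) unfolding ham_list_def successively_append_iff by auto
  then have walk: "awalk u ?p u"
    using awalk_zip[OF u, of "ws @ [u]"] by simp
  have ne: "?p \<noteq> []" by (cases ws) auto
  have "awalk_verts u ?p = map fst ?p @ [snd (last ?p)]"
    using ne by (simp add: awalk_verts_conv del: map_fst_zip)
  also have "snd (last ?p) = last (map snd ?p)"
    using ne by (simp add: last_map)
  also have "map snd ?p = ws @ [u]" by (simp add: map_snd_zip_take)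
  \<comment> \<open>\<open>cycle\<close> demands distinctness of the tail \<open>ws @ [u]\<close> of
    this list, a rotation of \<open>u # ws\<close>.\<close>
  finally have "awalk_verts u ?p = u # ws @ [u]"
    using fst by simp
  then have "cycle ?p"
    using walk ne assms(2) unfolding cycle_def ham_list_def by (intro exI[of _ u]) auto
  moreover have "3 \<le> length ?p" using assms(3) by simp
  moreover have "set (map fst ?p) = pverts G"
    unfolding fst using assms(2) by (simp add: ham_list_def)
  ultimately show "hamiltonian_cycle G ?p" by (simp add: hamiltonian_cycle_def)
qed

lemma visits_in_order_Cons: "subseq vs ws \<Longrightarrow> visits_in_order (v # ws) (v # vs)"
  by (auto intro!: exI[of _ 0])

section \<open>Adjacency in the cube along the Hamiltonian cycle\<close>

lemma graph_power_arc_sym: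
  assumes "pair_graph G" "(v, w) \<in> parcs (graph_power G k)"
  shows "(w, v) \<in> parcs (graph_power G k)"
proof -
  interpret pair_graph "graph_power G k" by (rule pair_graph_graph_power) fact
  show ?thesis using pair_sym_arcs assms(2) by (auto simp: symmetric_def dest: symD)
qed

text \<open>The distance is an infimum over walks, so a single walk bounds it.\<close>

lemma graph_power_arcI:
  assumes "pair_graph G" "pre_digraph.awalk (with_proj G) v p w" "length p \<le> k" "v \<noteq> w"
  shows "(v, w) \<in> parcs (graph_power G k)"
proof -
  interpret pair_graph G by fact
  have "awalk_cost (\<lambda>_. 1) q = real (length q)" for q
    by (induction q) (auto simp: awalk_cost_def)
  moreover have "\<mu> (\<lambda>_. 1) v w \<le> awalk_cost (\<lambda>_. 1) p"
    unfolding \<mu>_def using assms by (intro INF_lower) auto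
  ultimately have "\<mu> (\<lambda>_. 1) v w \<le> ereal (real (length p))"
    by simp
  also have "\<dots> \<le> ereal (real k)" using assms by simp
  finally show ?thesis
    using assms awalk_hd_in_verts awalk_last_in_verts by (auto simp: graph_power_def graph_dist_def)
qed

text \<open>Following the cycle from position \<open>i\<close> to \<open>j\<close> gives a walk of
  \<open>j - i\<close> arcs, so near positions are at distance at most 3 in
  \<open>G\<close>.\<close>

lemma cyclic_sequence_graph_power_3:
  assumes G: "pair_graph G" and p: "hamiltonian_cycle G p" and n: "5 \<le> card (pverts G)"
  shows "cyclic_sequence (\<lambda>i. fst (p ! (i mod length p))) (length p) (pverts G)
    (\<lambda>v w. (v, w) \<in> parcs (graph_power G 3))"
proof -
  interpret pair_graph G by fact
  let ?n = "length p" and ?f = "\<lambda>i. fst (p ! (i mod length p))"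
  obtain u where u: "awalk u p u" "distinct (tl (awalk_verts u p))" "p \<noteq> []"
    using p by (auto simp: hamiltonian_cycle_def cycle_def)
  have set_p: "set (map fst p) = pverts G" using p by (simp add: hamiltonian_cycle_def)
  obtain e p' where ep: "p = e # p'" using u by (cases p) auto
  have verts: "awalk_verts u p = map fst p @ [u]"
    using u awlast_if_cas[of u p u] by (auto simp: awalk_verts_conv awalk_def)
  have "fst e = u" using u ep by (auto simp: awalk_Cons_iff)
  then have dist: "distinct (map fst p)" using u verts ep by simp
  have card: "card (pverts G) = ?n"
    using distinct_card[OF dist] set_p by simp
  have image: "?f ` {..<?n} = pverts G"
    using set_p by (auto simp: set_conv_nth) (use u in force)+
  have inj: "i mod ?n = j mod ?n" if "?f i = ?f j" for i j
    using that dist u by (simp add: distinct_conv_nth) (metis length_greater_0_conv mod_less_divisor)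
  have step: "(?f i, ?f (Suc i)) \<in> parcs G" for i
  proof -
    \<comment> \<open>Listing the vertices of the closed walk by starts and by ends of arcs shows
      that each arc ends where the cyclically next one starts.\<close>
    have *: "snd (p ! j) = fst (p ! (Suc j mod ?n))" if "j < ?n" for j
    proof -
      have "map fst p @ [u] = u # map snd p"
        using u verts awalk_verts_conv'[of u p u] \<open>fst e = u\<close> ep by (simp add: awalk_def)
      then have "(map fst p @ [u]) ! Suc j = snd (p ! j)" using that by simp
      then show ?thesis
        using that \<open>fst e = u\<close> ep by (cases "Suc j = ?n") (auto simp: nth_append)
    qed
    have "p ! (i mod ?n) \<in> parcs G"
      using u by (auto simp: awalk_def)
    moreover have "p ! (i mod ?n) = (?f i, ?f (Suc i))"
      using *[of "i mod ?n"] u by (simp add: prod_eq_iff mod_Suc_eq)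
    ultimately show ?thesis by simp
  qed
  have walk: "\<exists>q. awalk (?f i) q (?f (i + k)) \<and> length q = k" for i k
  proof (induction k arbitrary: i)
    case 0
    show ?case using image step[of i] by (auto simp: awalk_Nil_iff dest: in_arcsD1)
  next
    case (Suc k)
    obtain q where "awalk (?f (Suc i)) q (?f (Suc i + k))" "length q = k"
      using Suc.IH by blast
    then show ?case
      using step[of i] by (intro exI[of _ "(?f i, ?f (Suc i)) # q"]) (auto simp: awalk_Cons_iff)
  qed
  have arc: "(?f i, ?f j) \<in> parcs (graph_power G 3)" if ij: "i < j" "j \<le> i + 3" for i j
  proof -
    obtain q where "awalk (?f i) q (?f (i + (j - i)))" "length q = j - i"
      using walk by blast
    moreover have "?f i \<noteq> ?f j"
    proof
      assume "?f i = ?f j"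
      \<comment> \<open>Equal vertices would sit at positions congruent modulo the length, but
        \<open>0 < j - i \<le> 3\<close> while the length is at least \<open>5\<close>.\<close>
      then have "?n dvd j - i" using inj[of i j] ij by (metis mod_eq_dvd_iff_nat less_imp_le)
      then show False using ij n card by (auto dest: dvd_imp_le)
    qed
    ultimately show ?thesis using ij by (intro graph_power_arcI[OF G]) auto
  qed
  show ?thesis
  proof
    show "(?f i, ?f j) \<in> parcs (graph_power G 3)" if "near i j" for i j
      using that arc[of i j] graph_power_arc_sym[OF G arc[of j i]]
      by (cases "i < j") (auto simp: near_def)
    show "symp (\<lambda>v w. (v, w) \<in> parcs (graph_power G 3))"
      using graph_power_arc_sym[OF G] by (intro sympI)
  qed (use image card n in auto)
qed

theorem corollary6p2:
  fixes G :: "'a pair_pre_digraph"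
  assumes "pair_graph G"
    and "hamiltonian G"
    and "card (pverts G) \<ge> 5"
  shows "ordered_hamiltonian 5 (graph_power G 3)"
  unfolding ordered_hamiltonian_def
proof (intro allI impI)
  fix vs :: "'a list"
  assume vs: "length vs = 5 \<and> distinct vs \<and> set vs \<subseteq> pverts (graph_power G 3)"
  let ?V = "pverts G" and ?E = "\<lambda>v w. (v, w) \<in> parcs (graph_power G 3)"
  have V: "pverts (graph_power G 3) = ?V" by (simp add: graph_power_def)
  obtain g n where "cyclic_sequence g n ?V ?E"
    using assms cyclic_sequence_graph_power_3 unfolding hamiltonian_def by blast
  then interpret g: cyclic_sequence g n ?V ?E .
  obtain v0 v1 v2 v3 v4 where vs_eq: "vs = [v0, v1, v2, v3, v4]"
    using vs by (auto simp: length_Suc_conv numeral_eq_Suc)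
  have "v0 \<in> g ` {..<n}" using vs V vs_eq g.image_f by auto
  then obtain b where b: "g b = v0" by blast
  \<comment> \<open>Shifting by \<open>b\<close> puts \<open>v0\<close> at position
    \<open>0\<close>, where the order results expect the first vertex.\<close>
  interpret f: cyclic_sequence "\<lambda>i. g (b + i)" n ?V ?E
    by (rule g.shift)
  let ?f = "\<lambda>i. g (b + i)"
  have "\<exists>i<n. ?f i = v" if "v \<in> set vs" for v
    using that vs V f.image_f by (metis (no_types, lifting) imageE lessThan_iff subsetD)
  then obtain p q r s where "p < n" "q < n" "r < n" "s < n"
    and f: "?f p = v1" "?f q = v2" "?f r = v3" "?f s = v4"
    unfolding vs_eq by (metis list.set_intros)
  moreover have "distinct (map ?f [0, p, q, r, s])"
    using vs b f by (simp add: vs_eq)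
  then have "distinct [0, p, q, r, s]"
    by (simp only: distinct_map)
  ultimately have "traverses ?E ?V (map ?f [0, p, q, r, s])"
    by (intro f.traverses_from_0)
  then have "traverses ?E ?V vs"
    using b f by (simp add: vs_eq)
  then obtain ws where ws: "ham_list ?E ?V (v0 # ws)" "subseq [v1, v2, v3, v4] ws"
    by (auto simp: traverses_def vs_eq)
  have "2 \<le> length ws"
    using list_emb_length[OF ws(2)] by simp
  then obtain p where "hamiltonian_cycle (graph_power G 3) p" "map fst p = v0 # ws"
    using hamiltonian_cycle_if_ham_list[OF pair_graph_graph_power[OF assms(1)]] ws(1) V by metis
  moreover have "visits_in_order (v0 # ws) vs"
    unfolding vs_eq using ws(2) by (rule visits_in_order_Cons)
  ultimately show "\<exists>p. hamiltonian_cycle (graph_power G 3) p \<and> visits_in_order (map fst p) vs"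
    by metis
qed

end
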